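(* Let $\mathcal{E}=(V,\langle\cdot,\cdot\rangle)$ be a finite dimensional real inner product space and let $X$ be a centered random vector in $\mathcal{E}$ with positive definite covariance $\Sigma$. Let $C$ be a non-empty Borel subset of $V$ and let $b\in V$, $b\neq 0$. Then, for all $u\in C^*$ such that $\langle u,b\rangle>0$, $$\Pr\{X\succeq_C b\}\leq \frac{\langle u,\Sigma(u)\rangle}{\langle u,b\rangle^2+\langle u,\Sigma(u)\rangle}.$$ If $C$ is a closed convex cone in $\mathcal{E}$ and $b\in V\setminus(-C)$, then $\mathfrak{a}(b,C)$ is non-empty and $$\Pr\{X\succeq_C b\}\leq \inf_{u\in \mathfrak{a}(b,C)} \frac{\langle u,\Sigma(u)\rangle}{\langle u,b\rangle^2+\langle u,\Sigma(u)\rangle}=\inf_{u\in \mathfrak{b}(b+C)}\frac{\langle u,\Sigma(u)\rangle}{1+\langle u,\Sigma(u)\rangle}.$$ Moreover, the latter bound is sharp, in the sense that (for such $C$ and $b$) there exists a centered random vector $X_0$ in $\mathcal{E}$ with covariance $\Sigma$ such that $\Pr\{X_0\succeq_C b\}$ equals the infimum above.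
   Context: A random vector in $\mathcal{E}=(V,\langle\cdot,\cdot\rangle)$ is a measurable map $X$ from a probability space to $V$ equipped with its Borel $\sigma$-algebra. It is centered if $\mathbb{E}(\langle v,X\rangle)=0$ for all $v\in V$. If $\langle u,X\rangle$ has finite variance for every $u\in V$, the covariance of a centered random vector $X$ is the unique positive semi-definite self-adjoint endomorphism $\Sigma$ of $V$ with $\mathbb{E}(\langle u,X\rangle\langle v,X\rangle)=\langle u,\Sigma(v)\rangle$ for all $u,v\in V$; it is positive definite if $\langle u,\Sigma(u)\rangle>0$ for all $u\neq0$. A cone in $\mathcal{E}$ is a subset $C\subseteq V$ with $\lambda C\subseteq C$ for every $\lambda>0$; it is a convex cone if moreover $C+C\subseteq C$. By convention cones are non-empty and non-trivial (different from $\{0\}$). For non-empty $C\subseteq V$, the dual of $C$ is $C^*=\{u\in V\mid \langle u,v\rangle\geq 0 \text{ for all } v\in C\}$. For $x,y\in V$, $y\succeq_C x$ means $y-x\in C$. For a cone $C$ and $b\in V$, $\mathfrak{a}(b,C)=C^*\cap\{u\in V\mid \langle u,b\rangle>0\}$. For $T\subseteq V$, the blocker of $T$ is $\mathfrak{b}(T)=\{u\in V \mid \langle u,x\rangle\geq 1 \text{ for all } x\in T\}$. *)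

theory Defs
  imports "HOL-Probability.Probability"
begin

text \<open>Integrability is part of the definition because the Bochner integral of a
  non-integrable function is 0 by convention.\<close>

definition centered :: "'w measure \<Rightarrow> ('w \<Rightarrow> 'a::euclidean_space) \<Rightarrow> bool" where
  "centered M X \<longleftrightarrow>
     (\<forall>v. integrable M (\<lambda>\<omega>. v \<bullet> X \<omega>) \<and> (\<integral>\<omega>. v \<bullet> X \<omega> \<partial>M) = 0)"

definition self_adjoint :: "('a::euclidean_space \<Rightarrow> 'a) \<Rightarrow> bool" where
  "self_adjoint T \<longleftrightarrow> linear T \<and> (\<forall>u v. T u \<bullet> v = u \<bullet> T v)"

definition pos_semidef :: "('a::euclidean_space \<Rightarrow> 'a) \<Rightarrow> bool" where
  "pos_semidef T \<longleftrightarrow> (\<forall>u. 0 \<le> u \<bullet> T u)"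

definition pos_def :: "('a::euclidean_space \<Rightarrow> 'a) \<Rightarrow> bool" where
  "pos_def T \<longleftrightarrow> (\<forall>u. u \<noteq> 0 \<longrightarrow> 0 < u \<bullet> T u)"

text \<open>\<open>\<Sigma>\<close> is the covariance of the centered random vector \<open>X\<close>; the square-integrability
  clause says that every \<open>u \<bullet> X\<close> has finite variance.\<close>

definition has_covariance ::
    "'w measure \<Rightarrow> ('w \<Rightarrow> 'a::euclidean_space) \<Rightarrow> ('a \<Rightarrow> 'a) \<Rightarrow> bool" where
  "has_covariance M X \<Sigma> \<longleftrightarrow>
     (\<forall>u. integrable M (\<lambda>\<omega>. (u \<bullet> X \<omega>)\<^sup>2)) \<and>
     self_adjoint \<Sigma> \<and> pos_semidef \<Sigma> \<and>
     (\<forall>u v. (\<integral>\<omega>. (u \<bullet> X \<omega>) * (v \<bullet> X \<omega>) \<partial>M) = u \<bullet> \<Sigma> v)"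

lemma has_covariance_unique:
  assumes "has_covariance M X \<Sigma>" and "has_covariance M X T"
  shows "\<Sigma> = T"
proof
  fix v
  have "u \<bullet> \<Sigma> v = u \<bullet> T v" for u
    using assms unfolding has_covariance_def by metis
  then show "\<Sigma> v = T v"
    using vector_eq_rdot by (metis inner_commute)
qed

text \<open>Unlike the library's \<^const>\<open>cone\<close>, only strictly positive scalars are required here,
  so a cone need not contain 0; and the empty set and \<open>{0}\<close> are excluded.\<close>

definition nontrivial_cone :: "'a::euclidean_space set \<Rightarrow> bool" where
  "nontrivial_cone C \<longleftrightarrow>
     C \<noteq> {} \<and> C \<noteq> {0} \<and> (\<forall>c>0. \<forall>x\<in>C. c *\<^sub>R x \<in> C)"

definition nontrivial_convex_cone :: "'a::euclidean_space set \<Rightarrow> bool" where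
  "nontrivial_convex_cone C \<longleftrightarrow>
     nontrivial_cone C \<and> (\<forall>x\<in>C. \<forall>y\<in>C. x + y \<in> C)"

definition dual :: "'a::euclidean_space set \<Rightarrow> 'a set" where
  "dual C = {u. \<forall>v\<in>C. 0 \<le> u \<bullet> v}"

text \<open>\<open>cone_ge C y x\<close> stands for \<open>y \<succeq>\<^sub>C x\<close>.\<close>

definition cone_ge :: "'a::euclidean_space set \<Rightarrow> 'a \<Rightarrow> 'a \<Rightarrow> bool" where
  "cone_ge C y x \<longleftrightarrow> y - x \<in> C"

definition admissible :: "'a::euclidean_space \<Rightarrow> 'a set \<Rightarrow> 'a set" where
  "admissible b C = dual C \<inter> {u. 0 < u \<bullet> b}"

definition blocker :: "'a::euclidean_space set \<Rightarrow> 'a set" where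
  "blocker T = {u. \<forall>x\<in>T. 1 \<le> u \<bullet> x}"

end

theory Submission
  imports Defs
begin

text \<open>If \<open>u\<close> lies in the dual of \<open>C\<close>, then \<open>X - b \<in> C\<close> forces the scalar variable \<open>u \<bullet> X\<close> to be at
least \<open>u \<bullet> b\<close>, so Cantelli's one-sided Chebyshev inequality for \<open>u \<bullet> X\<close>, whose variance is
\<open>u \<bullet> \<Sigma> u\<close>, gives the first bound (\<open>Cantelli_cone\<close>). The bound depends on \<open>u\<close> only up to a
positive factor; normalising \<open>u \<bullet> b\<close> to 1 turns the infimum over the admissible vectors into
the one over the blocker (\<open>INF_admissible_eq_INF_blocker\<close>).

Sharpness, and the existence of an admissible vector, both come from one minimisation. Among
the points of the closed convex set \<open>b + C\<close>, which misses the origin, there is a closest one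
\<open>z\<close> to the origin for the norm given by the inverse of \<open>\<Sigma>\<close>. Its supporting hyperplane is
\<open>u \<bullet> x = 1\<close> for some \<open>u\<close> in the blocker with \<open>\<Sigma> u = q z\<close>, where \<open>q = u \<bullet> \<Sigma> u\<close>
(\<open>ex_extremal_direction\<close>). This proportionality is exactly what allows a centered law with
covariance \<open>\<Sigma>\<close> to charge the single point \<open>z \<in> b + C\<close> with mass \<open>q / (1 + q)\<close>
(\<open>ex_covariance_with_atom\<close>). For such a law the upper bound just proved, applied to that law
itself, closes a chain
\<open>q / (1 + q) \<le> probability \<le> infimum \<le> value at u = q / (1 + q)\<close>,
so all four are equal; the optimality of \<open>u\<close> in the blocker comes out of the chain as well.\<close>

section \<open>The one-sided Chebyshev inequality on cones\<close>

text \<open>On the event, \<open>(u \<bullet> X + s)\<^sup>2\<close> is at least \<open>(t + s)\<^sup>2\<close> for every shift \<open>s \<ge> 0\<close>; comparing with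
its mean \<open>q + s\<^sup>2\<close>, where \<open>q = u \<bullet> \<Sigma> u\<close>, gives Cantelli's inequality for the best shift.\<close>

lemma centered_Cantelli:
  fixes X :: "'w \<Rightarrow> 'a::euclidean_space"
  assumes "prob_space M" and X: "X \<in> borel_measurable M"
    and cen: "centered M X" and cov: "has_covariance M X \<Sigma>"
    and t: "0 < t" and A: "A \<in> sets M" "\<And>\<omega>. \<omega> \<in> A \<Longrightarrow> t \<le> u \<bullet> X \<omega>"
  shows "measure M A \<le> (u \<bullet> \<Sigma> u) / (t\<^sup>2 + u \<bullet> \<Sigma> u)"
proof -
  interpret prob_space M by fact
  define q where "q = u \<bullet> \<Sigma> u"
  \<comment> \<open>the minimiser of \<open>(q + s\<^sup>2) / (t + s)\<^sup>2\<close> over \<open>s \<ge> 0\<close>\<close>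
  define s where "s = q / t"
  have q0: "0 \<le> q" using cov by (simp add: has_covariance_def pos_semidef_def q_def)
  have s0: "0 \<le> s" using q0 t by (simp add: s_def)
  have i1: "integrable M (\<lambda>\<omega>. u \<bullet> X \<omega>)" and e1: "(\<integral>\<omega>. u \<bullet> X \<omega> \<partial>M) = 0"
    using cen by (auto simp: centered_def)
  have i2: "integrable M (\<lambda>\<omega>. (u \<bullet> X \<omega>)\<^sup>2)" and e2: "(\<integral>\<omega>. (u \<bullet> X \<omega>)\<^sup>2 \<partial>M) = q"
    using cov by (auto simp: has_covariance_def q_def power2_eq_square)
  have eq: "(u \<bullet> X \<omega> + s)\<^sup>2 = (u \<bullet> X \<omega>)\<^sup>2 + 2 * s * (u \<bullet> X \<omega>) + s\<^sup>2" for \<omega>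
    by (simp add: power2_eq_square algebra_simps)
  have i3: "integrable M (\<lambda>\<omega>. (u \<bullet> X \<omega> + s)\<^sup>2)"
    unfolding eq using i1 i2 by auto
  have e3: "(\<integral>\<omega>. (u \<bullet> X \<omega> + s)\<^sup>2 \<partial>M) = q + s\<^sup>2"
    unfolding eq using i1 i2 e1 e2 by (simp add: prob_space)
  have "(t + s)\<^sup>2 * measure M A = (\<integral>\<omega>. (t + s)\<^sup>2 * indicator A \<omega> \<partial>M)"
    using A by simp
  also have "\<dots> \<le> (\<integral>\<omega>. (u \<bullet> X \<omega> + s)\<^sup>2 \<partial>M)"
  proof (rule integral_mono)
    show "integrable M (\<lambda>\<omega>. (t + s)\<^sup>2 * indicator A \<omega>)"
      using A(1) by (simp add: integrable_real_mult_indicator emeasure_eq_measure)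
    show "(t + s)\<^sup>2 * indicator A \<omega> \<le> (u \<bullet> X \<omega> + s)\<^sup>2" for \<omega>
      using A(2)[of \<omega>] t s0 by (auto simp: indicator_def intro!: power_mono)
  qed (rule i3)
  finally have "measure M A \<le> (q + s\<^sup>2) / (t + s)\<^sup>2"
    using t s0 by (simp add: e3 pos_le_divide_eq mult.commute)
  also have "(q + s\<^sup>2) / (t + s)\<^sup>2 = q / (t\<^sup>2 + q)"
  proof -
    have st: "q = s * t" using t by (simp add: s_def)
    have "(q + s\<^sup>2) / (t + s)\<^sup>2 = (s * (t + s)) / ((t + s) * (t + s))"
      by (simp add: st power2_eq_square algebra_simps)
    also have "\<dots> = s * t / (t * (t + s))"
      using mult_divide_mult_cancel_right[of "t + s" s "t + s"]
        mult_divide_mult_cancel_left[of t s "t + s"] t s0 by (simp add: mult.commute)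
    also have "\<dots> = q / (t\<^sup>2 + q)"
      by (simp add: st power2_eq_square algebra_simps)
    finally show ?thesis .
  qed
  finally show ?thesis by (simp add: q_def)
qed

lemma Cantelli_cone:
  fixes X :: "'w \<Rightarrow> 'a::euclidean_space"
  assumes "prob_space M" and X[measurable]: "X \<in> borel_measurable M"
    and "centered M X" and "has_covariance M X \<Sigma>"
    and C[measurable]: "C \<in> sets borel" and u: "u \<in> dual C" "0 < u \<bullet> b"
  shows "measure M {\<omega> \<in> space M. cone_ge C (X \<omega>) b} \<le> (u \<bullet> \<Sigma> u) / ((u \<bullet> b)\<^sup>2 + u \<bullet> \<Sigma> u)"
proof (rule centered_Cantelli[OF assms(1-4) u(2)])
  show "{\<omega> \<in> space M. cone_ge C (X \<omega>) b} \<in> sets M"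
    unfolding cone_ge_def by measurable
  show "u \<bullet> b \<le> u \<bullet> X \<omega>" if "\<omega> \<in> {\<omega> \<in> space M. cone_ge C (X \<omega>) b}" for \<omega>
    using that u(1) by (auto simp: cone_ge_def dual_def inner_diff_right)
qed

lemma Cantelli_cone_INF:
  fixes X :: "'w \<Rightarrow> 'a::euclidean_space"
  assumes "prob_space M" and "X \<in> borel_measurable M"
    and "centered M X" and "has_covariance M X \<Sigma>"
    and "C \<in> sets borel" and "admissible b C \<noteq> {}"
  shows "measure M {\<omega> \<in> space M. cone_ge C (X \<omega>) b}
    \<le> (INF u\<in>admissible b C. (u \<bullet> \<Sigma> u) / ((u \<bullet> b)\<^sup>2 + u \<bullet> \<Sigma> u))"
  using assms(6) by (rule cINF_greatest)
    (auto simp: admissible_def intro: Cantelli_cone[OF assms(1-5)])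

section \<open>Admissible vectors and the blocker\<close>

lemma closed_cone_contains_0:
  assumes "closed C" and "nontrivial_cone C"
  shows "0 \<in> C"
proof -
  obtain x where "x \<in> C" using assms(2) by (auto simp: nontrivial_cone_def)
  then have "inverse (real (Suc n)) *\<^sub>R x \<in> C" for n
    using assms(2) unfolding nontrivial_cone_def by (simp del: of_nat_Suc)
  moreover have "(\<lambda>n. inverse (real (Suc n)) *\<^sub>R x) \<longlonglongrightarrow> 0 *\<^sub>R x"
    by (intro tendsto_intros LIMSEQ_inverse_real_of_nat)
  ultimately have "0 *\<^sub>R x \<in> C" by (rule closed_sequentially[OF assms(1)])
  then show ?thesis by simp
qed

text \<open>A linear function bounded below on a cone is nonnegative there, and the cone contains \<open>0\<close>, so
the infimum of \<open>u\<close> over \<open>b + C\<close> is attained at \<open>b\<close>.\<close>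

lemma blocker_translated_cone:
  assumes "closed C" and "nontrivial_cone C"
  shows "blocker ((+) b ` C) = dual C \<inter> {u. 1 \<le> u \<bullet> b}"
proof (intro equalityI subsetI)
  fix u assume "u \<in> blocker ((+) b ` C)"
  then have u: "1 \<le> u \<bullet> b + u \<bullet> x" if "x \<in> C" for x
    using that by (auto simp: blocker_def inner_add_right)
  have "0 \<le> u \<bullet> x" if x: "x \<in> C" for x
  proof (rule ccontr)
    assume neg: "\<not> 0 \<le> u \<bullet> x"
    \<comment> \<open>a scalar large enough for \<open>u \<bullet> (b + c *\<^sub>R x)\<close> to be negative\<close>
    define c where "c = (\<bar>u \<bullet> b\<bar> + 1) / - (u \<bullet> x)"
    have "0 < c" using neg by (auto simp: c_def intro!: divide_pos_neg add_nonneg_pos)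
    then have "c *\<^sub>R x \<in> C" using assms(2) x by (simp add: nontrivial_cone_def)
    from u[OF this] have "1 \<le> u \<bullet> b + c * (u \<bullet> x)" by simp
    moreover have "c * (u \<bullet> x) = - (\<bar>u \<bullet> b\<bar> + 1)" using neg by (simp add: c_def field_simps)
    ultimately show False by linarith
  qed
  then show "u \<in> dual C \<inter> {u. 1 \<le> u \<bullet> b}"
    using u[OF closed_cone_contains_0[OF assms]] by (auto simp: dual_def)
next
  fix u assume "u \<in> dual C \<inter> {u. 1 \<le> u \<bullet> b}"
  then show "u \<in> blocker ((+) b ` C)"
    by (fastforce simp: blocker_def dual_def inner_add_right)
qed

text \<open>The blocker consists of the admissible vectors with \<open>u \<bullet> b \<ge> 1\<close>, and replacing \<open>u \<bullet> b\<close> by the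
smaller number 1 only increases the quotient. Conversely the quotient on the left is invariant
under positive scaling of \<open>u\<close>, so that one may assume \<open>u \<bullet> b = 1\<close>, where both quotients
agree.\<close>

lemma INF_admissible_eq_INF_blocker:
  fixes \<Sigma> :: "'a::euclidean_space \<Rightarrow> 'a"
  assumes lin: "linear \<Sigma>" and psd: "pos_semidef \<Sigma>"
    and C: "closed C" "nontrivial_cone C" and ne: "blocker ((+) b ` C) \<noteq> {}"
  shows "(INF u\<in>admissible b C. (u \<bullet> \<Sigma> u) / ((u \<bullet> b)\<^sup>2 + u \<bullet> \<Sigma> u))
    = (INF u\<in>blocker ((+) b ` C). (u \<bullet> \<Sigma> u) / (1 + u \<bullet> \<Sigma> u))"
proof -
  have pos: "0 \<le> u \<bullet> \<Sigma> u" for u using psd by (simp add: pos_semidef_def)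
  have bl: "blocker ((+) b ` C) = dual C \<inter> {u. 1 \<le> u \<bullet> b}"
    by (rule blocker_translated_cone[OF C])
  have sub: "blocker ((+) b ` C) \<subseteq> admissible b C"
    unfolding bl admissible_def by auto
  show ?thesis
  proof (rule antisym)
    show "(INF u\<in>admissible b C. (u \<bullet> \<Sigma> u) / ((u \<bullet> b)\<^sup>2 + u \<bullet> \<Sigma> u))
      \<le> (INF u\<in>blocker ((+) b ` C). (u \<bullet> \<Sigma> u) / (1 + u \<bullet> \<Sigma> u))"
    proof (rule cINF_mono[OF ne])
      show "bdd_below ((\<lambda>u. (u \<bullet> \<Sigma> u) / ((u \<bullet> b)\<^sup>2 + u \<bullet> \<Sigma> u)) ` admissible b C)"
        by (rule bdd_belowI2[of _ 0]) (simp add: pos)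
      fix u assume u: "u \<in> blocker ((+) b ` C)"
      then have "1 \<le> (u \<bullet> b)\<^sup>2" by (simp add: bl)
      then have "(u \<bullet> \<Sigma> u) / ((u \<bullet> b)\<^sup>2 + u \<bullet> \<Sigma> u) \<le> (u \<bullet> \<Sigma> u) / (1 + u \<bullet> \<Sigma> u)"
        using pos[of u] by (intro divide_left_mono mult_pos_pos) auto
      then show "\<exists>w\<in>admissible b C. (w \<bullet> \<Sigma> w) / ((w \<bullet> b)\<^sup>2 + w \<bullet> \<Sigma> w) \<le> (u \<bullet> \<Sigma> u) / (1 + u \<bullet> \<Sigma> u)"
        using u sub by blast
    qed
    show "(INF u\<in>blocker ((+) b ` C). (u \<bullet> \<Sigma> u) / (1 + u \<bullet> \<Sigma> u))
      \<le> (INF u\<in>admissible b C. (u \<bullet> \<Sigma> u) / ((u \<bullet> b)\<^sup>2 + u \<bullet> \<Sigma> u))"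
    proof (rule cINF_mono)
      show "admissible b C \<noteq> {}" using ne sub by auto
      show "bdd_below ((\<lambda>u. (u \<bullet> \<Sigma> u) / (1 + u \<bullet> \<Sigma> u)) ` blocker ((+) b ` C))"
        by (rule bdd_belowI2[of _ 0]) (simp add: pos)
      fix u assume u: "u \<in> admissible b C"
      then have ub: "0 < u \<bullet> b" by (simp add: admissible_def)
      define w where "w = u /\<^sub>R (u \<bullet> b)"
      have "w \<in> blocker ((+) b ` C)"
        using u ub by (auto simp: bl admissible_def dual_def w_def)
      moreover have "(w \<bullet> \<Sigma> w) / (1 + w \<bullet> \<Sigma> w) = (u \<bullet> \<Sigma> u) / ((u \<bullet> b)\<^sup>2 + u \<bullet> \<Sigma> u)"
      proof -
        have "w \<bullet> \<Sigma> w = (u \<bullet> \<Sigma> u) / (u \<bullet> b)\<^sup>2"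
          by (simp add: w_def linear_scale[OF lin] power2_eq_square field_simps)
        moreover have "a / t / (1 + a / t) = a / (t + a)" if "0 \<le> a" "0 < t" for a t :: real
          using that by (simp add: divide_simps)
        ultimately show ?thesis using pos[of u] ub by simp
      qed
      ultimately show "\<exists>w\<in>blocker ((+) b ` C). (w \<bullet> \<Sigma> w) / (1 + w \<bullet> \<Sigma> w)
          \<le> (u \<bullet> \<Sigma> u) / ((u \<bullet> b)\<^sup>2 + u \<bullet> \<Sigma> u)"
        by (metis order_refl)
    qed
  qed
qed

section \<open>The extremal direction\<close>

text \<open>By homogeneity it suffices to bound the quadratic form on the unit sphere, which is compact.\<close>

lemma pos_def_coercive:
  fixes \<Sigma> :: "'a::euclidean_space \<Rightarrow> 'a"
  assumes "linear \<Sigma>" and "pos_def \<Sigma>"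
  obtains c where "0 < c" "\<And>v. c * (norm v)\<^sup>2 \<le> v \<bullet> \<Sigma> v"
proof -
  have "continuous_on (sphere 0 1) (\<lambda>v. v \<bullet> \<Sigma> v)"
    by (intro continuous_intros linear_continuous_on linear_conv_bounded_linear[THEN iffD1] assms)
  moreover have "sphere (0::'a) 1 \<noteq> {}" by simp
  ultimately obtain w where w: "w \<in> sphere 0 1" "\<And>v. v \<in> sphere 0 1 \<Longrightarrow> w \<bullet> \<Sigma> w \<le> v \<bullet> \<Sigma> v"
    using continuous_attains_inf[OF compact_sphere] by blast
  show thesis
  proof (rule that)
    from w(1) have "w \<noteq> 0" by auto
    then show "0 < w \<bullet> \<Sigma> w" using assms(2) by (simp add: pos_def_def)
    fix v :: 'a
    show "(w \<bullet> \<Sigma> w) * (norm v)\<^sup>2 \<le> v \<bullet> \<Sigma> v"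
    proof (cases "v = 0")
      case False
      define e where "e = v /\<^sub>R norm v"
      have v: "v = norm v *\<^sub>R e" using False by (simp add: e_def)
      have "e \<in> sphere 0 1" using False by (simp add: e_def)
      then have "(w \<bullet> \<Sigma> w) * (norm v)\<^sup>2 \<le> (e \<bullet> \<Sigma> e) * (norm v)\<^sup>2"
        by (intro mult_right_mono w(2)) auto
      also have "\<dots> = (norm v *\<^sub>R e) \<bullet> \<Sigma> (norm v *\<^sub>R e)"
        by (simp add: linear_scale[OF assms(1)] power2_eq_square)
      also have "\<dots> = v \<bullet> \<Sigma> v" using v by simp
      finally show ?thesis .
    qed (simp add: linear_0[OF assms(1)])
  qed
qed

text \<open>The point \<open>\<Sigma> v\<^sub>0\<close> is the one in \<open>K\<close> closest to the origin for the norm given by the inverse of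
\<open>\<Sigma>\<close>, and the inequality is the variational characterisation of a closest point. Since
\<open>z = \<Sigma> v\<close> has squared norm \<open>v \<bullet> \<Sigma> v\<close>, minimising over the preimage of \<open>K\<close> avoids the inverse
altogether.\<close>

lemma ex_minimal_variance_vector:
  fixes \<Sigma> :: "'a::euclidean_space \<Rightarrow> 'a"
  assumes lin: "linear \<Sigma>" and sa: "\<And>u v. \<Sigma> u \<bullet> v = u \<bullet> \<Sigma> v" and pd: "pos_def \<Sigma>"
    and K: "closed K" "convex K" "K \<noteq> {}"
  obtains v\<^sub>0 where "\<Sigma> v\<^sub>0 \<in> K" "\<And>z. z \<in> K \<Longrightarrow> v\<^sub>0 \<bullet> \<Sigma> v\<^sub>0 \<le> v\<^sub>0 \<bullet> z"
proof -
  let ?f = "\<lambda>v. v \<bullet> \<Sigma> v"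
  define D where "D = \<Sigma> -` K"
  obtain c where c: "0 < c" "\<And>v. c * (norm v)\<^sup>2 \<le> ?f v"
    using pos_def_coercive[OF lin pd] by blast
  have contS: "continuous_on UNIV \<Sigma>"
    by (intro linear_continuous_on linear_conv_bounded_linear[THEN iffD1] lin)
  have contf: "continuous_on UNIV ?f"
    by (intro continuous_intros contS)
  have "inj \<Sigma>"
    unfolding linear_injective_0[OF lin]
    using pd unfolding pos_def_def by (metis inner_zero_right less_irrefl)
  then have surj: "surj \<Sigma>" by (rule linear_injective_imp_surjective[OF lin _ refl])
  have "D \<noteq> {}" using K(3) surj unfolding D_def by (metis surj_def vimage_eq ex_in_conv)
  then obtain v\<^sub>1 where v1: "v\<^sub>1 \<in> D" by blast
  have clD: "closed D" unfolding D_def using K(1) contS by (simp add: closed_vimage)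
  \<comment> \<open>cutting \<open>D\<close> down to a sublevel set makes it compact without losing the minimum\<close>
  define E where "E = D \<inter> {v. ?f v \<le> ?f v\<^sub>1}"
  have "closed E" unfolding E_def
    by (intro closed_Int clD closed_Collect_le contf continuous_on_const)
  moreover have "bounded E"
    unfolding bounded_iff
  proof (intro exI ballI)
    fix v assume "v \<in> E"
    then have "c * (norm v)\<^sup>2 \<le> ?f v\<^sub>1" using c(2)[of v] by (simp add: E_def)
    then have "(norm v)\<^sup>2 \<le> ?f v\<^sub>1 / c" using c(1) by (simp add: field_simps)
    then show "norm v \<le> sqrt (?f v\<^sub>1 / c)" by (rule real_le_rsqrt)
  qed
  ultimately have "compact E" by (simp add: compact_eq_bounded_closed)
  moreover have "E \<noteq> {}" using v1 by (auto simp: E_def)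
  ultimately obtain v\<^sub>0 where v0: "v\<^sub>0 \<in> E" "\<And>v. v \<in> E \<Longrightarrow> ?f v\<^sub>0 \<le> ?f v"
    using continuous_attains_inf[of E ?f] continuous_on_subset[OF contf] by blast
  have v0D: "v\<^sub>0 \<in> D" using v0(1) by (simp add: E_def)
  have min: "?f v\<^sub>0 \<le> ?f v" if "v \<in> D" for v
    using v0 that by (cases "?f v \<le> ?f v\<^sub>1") (auto simp: E_def)
  show thesis
  proof (rule that)
    show "\<Sigma> v\<^sub>0 \<in> K" using v0D by (simp add: D_def)
    fix z assume z: "z \<in> K"
    obtain v where v: "z = \<Sigma> v" using surj by (metis surj_def)
    define d where "d = v - v\<^sub>0"
    \<comment> \<open>moving from the minimiser towards \<open>v\<close> inside \<open>D\<close> cannot decrease the form; divide by \<open>t\<close>\<close>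
    have step: "0 \<le> 2 * (v\<^sub>0 \<bullet> \<Sigma> d) + t * ?f d" if t: "0 < t" "t \<le> 1" for t
    proof -
      have "\<Sigma> (v\<^sub>0 + t *\<^sub>R d) = (1 - t) *\<^sub>R \<Sigma> v\<^sub>0 + t *\<^sub>R z"
        by (simp add: d_def v linear_add[OF lin] linear_diff[OF lin] linear_scale[OF lin] algebra_simps)
      then have "v\<^sub>0 + t *\<^sub>R d \<in> D"
        using convexD[OF K(2) \<open>\<Sigma> v\<^sub>0 \<in> K\<close> z, of "1 - t" t] t by (simp add: D_def)
      then have "?f v\<^sub>0 \<le> ?f (v\<^sub>0 + t *\<^sub>R d)" by (rule min)
      also have "\<dots> = ?f v\<^sub>0 + t * (2 * (v\<^sub>0 \<bullet> \<Sigma> d) + t * ?f d)"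
        using sa[of v\<^sub>0 d]
        by (simp add: linear_add[OF lin] linear_scale[OF lin] inner_add_left inner_add_right
            inner_commute algebra_simps)
      finally have "0 \<le> t * (2 * (v\<^sub>0 \<bullet> \<Sigma> d) + t * ?f d)" by simp
      then show ?thesis using t by (simp add: zero_le_mult_iff)
    qed
    have "0 \<le> 2 * (v\<^sub>0 \<bullet> \<Sigma> d)"
    proof (rule tendsto_lowerbound)
      show "((\<lambda>t. 2 * (v\<^sub>0 \<bullet> \<Sigma> d) + t * ?f d) \<longlongrightarrow> 2 * (v\<^sub>0 \<bullet> \<Sigma> d)) (at_right 0)"
        by (auto intro!: tendsto_eq_intros)
      show "\<forall>\<^sub>F t in at_right 0. 0 \<le> 2 * (v\<^sub>0 \<bullet> \<Sigma> d) + t * ?f d"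
        using step by (auto simp: eventually_at_right_field intro!: exI[of _ 1])
    qed simp
    then show "?f v\<^sub>0 \<le> v\<^sub>0 \<bullet> z"
      by (simp add: d_def v linear_diff[OF lin] inner_diff_right)
  qed
qed

text \<open>Here \<open>z\<close> is \<open>\<Sigma> v\<close> for the vector \<open>v\<close> that \<open>ex_minimal_variance_vector\<close> yields for
\<open>K = b + C\<close>, and \<open>u\<close> is \<open>v\<close> scaled so that the minimum of the inner product with it over
\<open>b + C\<close>, which is attained at \<open>z\<close>, becomes 1. The hypothesis on \<open>b\<close> says
that \<open>b + C\<close> misses the origin, so that \<open>v\<close> is nonzero and the scaling is possible.\<close>

lemma ex_extremal_direction:
  fixes \<Sigma> :: "'a::euclidean_space \<Rightarrow> 'a"
  assumes sa: "self_adjoint \<Sigma>" and pd: "pos_def \<Sigma>"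
    and C: "closed C" "nontrivial_convex_cone C" and b: "b \<notin> uminus ` C"
  obtains u z where "u \<in> blocker ((+) b ` C)" "z \<in> (+) b ` C"
    "0 < u \<bullet> \<Sigma> u" "\<Sigma> u = (u \<bullet> \<Sigma> u) *\<^sub>R z"
proof -
  have lin: "linear \<Sigma>" and sa': "\<And>u v. \<Sigma> u \<bullet> v = u \<bullet> \<Sigma> v"
    using sa by (auto simp: self_adjoint_def)
  have cone: "nontrivial_cone C" using C(2) by (simp add: nontrivial_convex_cone_def)
  have "convex C"
  proof (rule convexI)
    fix x y and s t :: real
    assume xy: "x \<in> C" "y \<in> C" and st: "0 \<le> s" "0 \<le> t" "s + t = 1"
    have sc: "r *\<^sub>R w \<in> C" if "0 \<le> r" "w \<in> C" for r w
      using that cone closed_cone_contains_0[OF C(1) cone]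
      by (cases "r = 0") (auto simp: nontrivial_cone_def)
    show "s *\<^sub>R x + t *\<^sub>R y \<in> C"
      using C(2) sc xy st by (simp add: nontrivial_convex_cone_def)
  qed
  then have K: "closed ((+) b ` C)" "convex ((+) b ` C)" "(+) b ` C \<noteq> {}"
    using C(1) cone by (auto simp: closed_translation convex_translation nontrivial_cone_def)
  obtain v where v: "\<Sigma> v \<in> (+) b ` C" "\<And>z. z \<in> (+) b ` C \<Longrightarrow> v \<bullet> \<Sigma> v \<le> v \<bullet> z"
    using ex_minimal_variance_vector[OF lin sa' pd K] by blast
  have "0 \<notin> (+) b ` C"
    using b by (force simp: image_iff add_eq_0_iff2)
  then have "v \<noteq> 0" using v(1) linear_0[OF lin] by metis
  then have m: "0 < v \<bullet> \<Sigma> v" using pd by (simp add: pos_def_def)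
  define u where "u = v /\<^sub>R (v \<bullet> \<Sigma> v)"
  have uu: "u \<bullet> \<Sigma> u = inverse (v \<bullet> \<Sigma> v)"
    using m by (simp add: u_def linear_scale[OF lin])
  show thesis
  proof (rule that[of u "\<Sigma> v"])
    show "u \<in> blocker ((+) b ` C)"
      using v(2) m by (auto simp: blocker_def u_def field_simps)
    show "\<Sigma> u = (u \<bullet> \<Sigma> u) *\<^sub>R \<Sigma> v" by (simp add: uu) (simp add: u_def linear_scale[OF lin])
  qed (use v m uu in auto)
qed

section \<open>A law with prescribed covariance and a large atom\<close>

text \<open>The law of the variable that is \<open>z\<close> or \<open>h\<close> according to an independent coin with success
probability \<open>p\<close>. It is described through its integrals because moments and probabilities are
all that is needed of it.\<close>

lemma ex_mixture_with_point:
  fixes h :: "'w \<Rightarrow> 'a::euclidean_space"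
  assumes M: "prob_space M" and h[measurable]: "h \<in> borel_measurable M"
    and p: "0 \<le> p" "p \<le> 1"
  obtains N :: "'a measure" where "prob_space N" "sets N = sets borel"
    "\<And>g :: 'a \<Rightarrow> real. g \<in> borel_measurable borel \<Longrightarrow> integrable M (\<lambda>\<omega>. g (h \<omega>)) \<Longrightarrow>
       integrable N g \<and> (\<integral>x. g x \<partial>N) = p * g z + (1 - p) * (\<integral>\<omega>. g (h \<omega>) \<partial>M)"
proof -
  interpret M: prob_space M by fact
  define P where "P = measure_pmf (bernoulli_pmf p)"
  interpret PP: prob_space P unfolding P_def by (rule prob_space_measure_pmf)
  interpret pair_prob_space P M ..
  have setsP [measurable_cong]: "sets P = sets (count_space UNIV)" by (simp add: P_def)
  define Y where "Y = (\<lambda>(B, \<omega>). if B then z else h \<omega>)"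
  have Y[measurable]: "Y \<in> borel_measurable (P \<Otimes>\<^sub>M M)"
    unfolding Y_def by measurable
  show thesis
  proof (rule that[of "distr (P \<Otimes>\<^sub>M M) borel Y"])
    show "prob_space (distr (P \<Otimes>\<^sub>M M) borel Y)"
      by (rule prob_space_distr) simp
    fix g :: "'a \<Rightarrow> real"
    assume g[measurable]: "g \<in> borel_measurable borel" and int: "integrable M (\<lambda>\<omega>. g (h \<omega>))"
    have intP: "integrable P f" for f :: "bool \<Rightarrow> real"
      unfolding P_def by (rule integrable_measure_pmf_finite) simp
    have sect: "integrable M (\<lambda>\<omega>. g (Y (B, \<omega>)))" for B
      using int by (cases B) (auto simp: Y_def)
    have intY: "integrable (P \<Otimes>\<^sub>M M) (\<lambda>x. g (Y x))"
      by (rule Fubini_integrable) (auto intro: intP sect)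
    have "(\<integral>x. g (Y x) \<partial>(P \<Otimes>\<^sub>M M)) = (\<integral>B. (\<integral>\<omega>. g (Y (B, \<omega>)) \<partial>M) \<partial>P)"
      by (rule integral_fst'[symmetric]) (rule intY)
    also have "\<dots> = p * g z + (1 - p) * (\<integral>\<omega>. g (h \<omega>) \<partial>M)"
      unfolding P_def using p by (subst integral_bernoulli_pmf) (simp_all add: Y_def M.prob_space)
    finally show "integrable (distr (P \<Otimes>\<^sub>M M) borel Y) g \<and>
      (\<integral>x. g x \<partial>(distr (P \<Otimes>\<^sub>M M) borel Y)) = p * g z + (1 - p) * (\<integral>\<omega>. g (h \<omega>) \<partial>M)"
      using intY by (simp add: integrable_distr_eq integral_distr)
  qed simp
qed

lemma has_covariance_integrable_mult:
  assumes "has_covariance M X \<Sigma>"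
  shows "integrable M (\<lambda>\<omega>. (u \<bullet> X \<omega>) * (v \<bullet> X \<omega>))"
proof -
  have "(u \<bullet> X \<omega>) * (v \<bullet> X \<omega>) = (((u + v) \<bullet> X \<omega>)\<^sup>2 - (u \<bullet> X \<omega>)\<^sup>2 - (v \<bullet> X \<omega>)\<^sup>2) / 2" for \<omega>
    by (simp add: inner_add_left power2_eq_square algebra_simps)
  then show ?thesis
    using assms by (simp only: has_covariance_def) simp
qed

text \<open>Since \<open>\<Sigma> u = q z\<close>, the projection \<open>X - (u \<bullet> X) z\<close> removes from \<open>X\<close> exactly its component
along \<open>z\<close> and leaves the covariance \<open>\<Sigma> - q z z\<^sup>T\<close>. The lost term \<open>q z z\<^sup>T\<close> is restored by
moving to \<open>z\<close> with probability \<open>q / (1 + q)\<close> and to \<open>- q z\<close> otherwise, a centered two-point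
variable with second moment \<open>q z z\<^sup>T\<close>. The projected vector is added only in the second case,
stretched by \<open>sqrt (1 + q)\<close> to make up for the probability \<open>1 / (1 + q)\<close> of that case, so that
\<open>z\<close> stays an atom.\<close>

lemma ex_covariance_with_atom:
  fixes X :: "'w \<Rightarrow> 'a::euclidean_space"
  assumes M: "prob_space M" and X[measurable]: "X \<in> borel_measurable M"
    and cen: "centered M X" and cov: "has_covariance M X \<Sigma>"
    and q: "0 < q" "u \<bullet> \<Sigma> u = q" and z: "\<Sigma> u = q *\<^sub>R z"
  obtains N :: "'a measure" where "prob_space N" "sets N = sets borel"
    "centered N (\<lambda>x. x)" "has_covariance N (\<lambda>x. x) \<Sigma>"
    "\<And>A. A \<in> sets borel \<Longrightarrow> z \<in> A \<Longrightarrow> q / (1 + q) \<le> measure N A"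
proof -
  interpret prob_space M by fact
  define s where "s = sqrt (1 + q)"
  have s2: "s * s = 1 + q" using q by (simp add: s_def)
  define h where "h \<omega> = s *\<^sub>R (X \<omega> - (u \<bullet> X \<omega>) *\<^sub>R z) - q *\<^sub>R z" for \<omega>
  have h[measurable]: "h \<in> borel_measurable M" unfolding h_def by measurable
  obtain N :: "'a measure" where N: "prob_space N" "sets N = sets borel"
    and int: "\<And>g :: 'a \<Rightarrow> real. g \<in> borel_measurable borel \<Longrightarrow> integrable M (\<lambda>\<omega>. g (h \<omega>)) \<Longrightarrow>
       integrable N g \<and> (\<integral>x. g x \<partial>N) = q / (1 + q) * g z + (1 - q / (1 + q)) * (\<integral>\<omega>. g (h \<omega>) \<partial>M)"
    using ex_mixture_with_point[OF M h, of "q / (1 + q)" z] q(1) by (auto simp: field_simps)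
  have p': "1 - q / (1 + q) = 1 / (1 + q)" using q(1) by (simp add: field_simps)
  interpret N: prob_space N by (rule N(1))
  \<comment> \<open>the adjoint of the projection \<open>x \<mapsto> x - (u \<bullet> x) z\<close>\<close>
  define \<pi> where "\<pi> v = v - (v \<bullet> z) *\<^sub>R u" for v
  have vh: "v \<bullet> h \<omega> = s * (\<pi> v \<bullet> X \<omega>) - q * (v \<bullet> z)" for v \<omega>
    by (simp add: h_def \<pi>_def inner_diff_right inner_diff_left algebra_simps)
  have i1: "integrable M (\<lambda>\<omega>. v \<bullet> X \<omega>)" and e1: "(\<integral>\<omega>. v \<bullet> X \<omega> \<partial>M) = 0" for v
    using cen by (auto simp: centered_def)
  note i2 = has_covariance_integrable_mult[OF cov]
  have e2: "(\<integral>\<omega>. (v \<bullet> X \<omega>) * (w \<bullet> X \<omega>) \<partial>M) = v \<bullet> \<Sigma> w" for v w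
    using cov by (simp add: has_covariance_def)
  have lin: "linear \<Sigma>" and sa: "\<And>v w. \<Sigma> v \<bullet> w = v \<bullet> \<Sigma> w"
    using cov by (auto simp: has_covariance_def self_adjoint_def)
  have uz: "u \<bullet> z = 1" using q z by simp
  have us: "u \<bullet> \<Sigma> v = q * (v \<bullet> z)" for v
    using sa[of u v] by (simp add: z inner_commute)
  have \<pi>\<Sigma>: "\<pi> v \<bullet> \<Sigma> (\<pi> w) = v \<bullet> \<Sigma> w - q * (v \<bullet> z) * (w \<bullet> z)" for v w
    unfolding \<pi>_def
    by (simp add: linear_diff[OF lin] linear_scale[OF lin] inner_diff_left inner_diff_right us z uz
        algebra_simps)
  have vhw: "(v \<bullet> h \<omega>) * (w \<bullet> h \<omega>) =
      (1 + q) * ((\<pi> v \<bullet> X \<omega>) * (\<pi> w \<bullet> X \<omega>)) - s * q * (w \<bullet> z) * (\<pi> v \<bullet> X \<omega>)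
      - s * q * (v \<bullet> z) * (\<pi> w \<bullet> X \<omega>) + q * q * (v \<bullet> z) * (w \<bullet> z)" for v w \<omega>
    unfolding vh s2[symmetric] by (simp add: algebra_simps)
  have ih2: "integrable M (\<lambda>\<omega>. (v \<bullet> h \<omega>) * (w \<bullet> h \<omega>))" for v w
    unfolding vhw using i1 i2 by auto
  have eh2: "(\<integral>\<omega>. (v \<bullet> h \<omega>) * (w \<bullet> h \<omega>) \<partial>M)
      = (1 + q) * (v \<bullet> \<Sigma> w) - q * (v \<bullet> z) * (w \<bullet> z)" for v w
    unfolding vhw using i1 i2 e1 e2
    by (simp add: prob_space \<pi>\<Sigma> algebra_simps)
  have c1: "integrable N (\<lambda>x. v \<bullet> x) \<and> (\<integral>x. v \<bullet> x \<partial>N) = 0" for v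
  proof -
    have "integrable M (\<lambda>\<omega>. v \<bullet> h \<omega>)" unfolding vh using i1 by auto
    moreover have "(\<integral>\<omega>. v \<bullet> h \<omega> \<partial>M) = - (q * (v \<bullet> z))"
      unfolding vh using i1 e1 by (simp add: prob_space)
    ultimately show ?thesis
      using int[of "\<lambda>x. v \<bullet> x"] by (simp add: p')
  qed
  have c2: "integrable N (\<lambda>x. (v \<bullet> x) * (w \<bullet> x)) \<and> (\<integral>x. (v \<bullet> x) * (w \<bullet> x) \<partial>N) = v \<bullet> \<Sigma> w" for v w
  proof -
    have "q / (1 + q) * ((v \<bullet> z) * (w \<bullet> z)) + (1 - q / (1 + q)) *
        ((1 + q) * (v \<bullet> \<Sigma> w) - q * (v \<bullet> z) * (w \<bullet> z)) = v \<bullet> \<Sigma> w"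
      unfolding p' using q(1) by (simp add: diff_divide_distrib right_diff_distrib)
    then show ?thesis
      using int[of "\<lambda>x. (v \<bullet> x) * (w \<bullet> x)"] ih2[of v w] by (simp add: eh2)
  qed
  show thesis
  proof (rule that[OF N])
    show "centered N (\<lambda>x. x)" using c1 by (simp add: centered_def)
    show "has_covariance N (\<lambda>x. x) \<Sigma>"
      using c2 cov by (simp add: has_covariance_def power2_eq_square)
    fix A :: "'a set" assume A[measurable]: "A \<in> sets borel" and "z \<in> A"
    have "integrable M (\<lambda>\<omega>. indicator A (h \<omega>) :: real)"
      by (rule integrable_const_bound[of _ 1]) (auto simp: indicator_def)
    then have "measure N A = q / (1 + q) + (1 / (1 + q)) * (\<integral>\<omega>. indicator A (h \<omega>) \<partial>M)"
      using int[of "indicator A"] N(2) A \<open>z \<in> A\<close> by (simp add: p')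
    moreover have "0 \<le> (1 / (1 + q)) * (\<integral>\<omega>. indicator A (h \<omega>) \<partial>M :: real)"
      using q(1) by (intro mult_nonneg_nonneg integral_nonneg) auto
    ultimately show "q / (1 + q) \<le> measure N A" by linarith
  qed
qed

section \<open>Sharpness of the bound\<close>

theorem theorem3:
  fixes M :: "'w measure" and X :: "'w \<Rightarrow> 'a::euclidean_space"
    and \<Sigma> :: "'a \<Rightarrow> 'a" and C :: "'a set" and b :: 'a
  assumes "prob_space M"
    and "X \<in> borel_measurable M"
    and "centered M X"
    and "has_covariance M X \<Sigma>"
    and "pos_def \<Sigma>"
    and "C \<noteq> {}"
    and "C \<in> sets borel"
    and "b \<noteq> 0"
  shows "(\<forall>u\<in>dual C. 0 < u \<bullet> b \<longrightarrow>
            measure M {\<omega> \<in> space M. cone_ge C (X \<omega>) b}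
              \<le> (u \<bullet> \<Sigma> u) / ((u \<bullet> b)\<^sup>2 + u \<bullet> \<Sigma> u)) \<and>
         (closed C \<and> nontrivial_convex_cone C \<and> b \<notin> uminus ` C \<longrightarrow>
            admissible b C \<noteq> {} \<and>
            measure M {\<omega> \<in> space M. cone_ge C (X \<omega>) b}
              \<le> (INF u\<in>admissible b C. (u \<bullet> \<Sigma> u) / ((u \<bullet> b)\<^sup>2 + u \<bullet> \<Sigma> u)) \<and>
            (INF u\<in>admissible b C. (u \<bullet> \<Sigma> u) / ((u \<bullet> b)\<^sup>2 + u \<bullet> \<Sigma> u))
              = (INF u\<in>blocker ((+) b ` C). (u \<bullet> \<Sigma> u) / (1 + u \<bullet> \<Sigma> u)) \<and>
            (\<exists>(N :: 'a measure) X\<^sub>0. prob_space N \<and> X\<^sub>0 \<in> borel_measurable N \<and>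
               centered N X\<^sub>0 \<and> has_covariance N X\<^sub>0 \<Sigma> \<and>
               measure N {\<omega> \<in> space N. cone_ge C (X\<^sub>0 \<omega>) b}
                 = (INF u\<in>blocker ((+) b ` C). (u \<bullet> \<Sigma> u) / (1 + u \<bullet> \<Sigma> u))))"
proof (intro conjI impI ballI)
  let ?I = "INF u\<in>blocker ((+) b ` C). (u \<bullet> \<Sigma> u) / (1 + u \<bullet> \<Sigma> u)"
  show "measure M {\<omega> \<in> space M. cone_ge C (X \<omega>) b} \<le> (u \<bullet> \<Sigma> u) / ((u \<bullet> b)\<^sup>2 + u \<bullet> \<Sigma> u)"
    if "u \<in> dual C" "0 < u \<bullet> b" for u
    by (rule Cantelli_cone[OF assms(1-4,7) that])
  assume "closed C \<and> nontrivial_convex_cone C \<and> b \<notin> uminus ` C"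
  then have C: "closed C" "nontrivial_convex_cone C" "b \<notin> uminus ` C" and cone: "nontrivial_cone C"
    by (auto simp: nontrivial_convex_cone_def)
  have sa: "self_adjoint \<Sigma>" and lin: "linear \<Sigma>" and psd: "pos_semidef \<Sigma>"
    using assms(4) by (auto simp: has_covariance_def self_adjoint_def)
  obtain u z where u: "u \<in> blocker ((+) b ` C)" and z: "z \<in> (+) b ` C"
    and q: "0 < u \<bullet> \<Sigma> u" and uz: "\<Sigma> u = (u \<bullet> \<Sigma> u) *\<^sub>R z"
    using ex_extremal_direction[OF sa assms(5) C] by blast
  show adm: "admissible b C \<noteq> {}"
    using u blocker_translated_cone[OF C(1) cone] by (auto simp: admissible_def)
  show eq: "(INF u\<in>admissible b C. (u \<bullet> \<Sigma> u) / ((u \<bullet> b)\<^sup>2 + u \<bullet> \<Sigma> u)) = ?I"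
    using u by (intro INF_admissible_eq_INF_blocker[OF lin psd C(1) cone]) auto
  show "measure M {\<omega> \<in> space M. cone_ge C (X \<omega>) b}
      \<le> (INF u\<in>admissible b C. (u \<bullet> \<Sigma> u) / ((u \<bullet> b)\<^sup>2 + u \<bullet> \<Sigma> u))"
    by (rule Cantelli_cone_INF[OF assms(1-4,7) adm])
  obtain N :: "'a measure" where N: "prob_space N" "sets N = sets borel"
    "centered N (\<lambda>x. x)" "has_covariance N (\<lambda>x. x) \<Sigma>"
    and atom: "\<And>A. A \<in> sets borel \<Longrightarrow> z \<in> A \<Longrightarrow> (u \<bullet> \<Sigma> u) / (1 + u \<bullet> \<Sigma> u) \<le> measure N A"
    using ex_covariance_with_atom[OF assms(1-4) q refl uz] by blast
  have meas: "(\<lambda>x. x) \<in> borel_measurable N" using N(2) by (simp add: measurable_ident_sets)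
  have sp: "space N = UNIV" using N(2) sets_eq_imp_space_eq[of N borel] by simp
  let ?A = "{x \<in> space N. cone_ge C x b}"
  have A: "?A = (+) b ` C"
    by (force simp: sp cone_ge_def image_iff)
  have "closed ?A" unfolding A using C(1) by (rule closed_translation)
  then have "(u \<bullet> \<Sigma> u) / (1 + u \<bullet> \<Sigma> u) \<le> measure N ?A"
    using z A by (intro atom borel_closed) auto
  moreover have "?I \<le> (u \<bullet> \<Sigma> u) / (1 + u \<bullet> \<Sigma> u)"
    using u psd by (intro cINF_lower bdd_belowI2[of _ 0]) (auto simp: pos_semidef_def)
  moreover have "measure N ?A \<le> ?I"
    using Cantelli_cone_INF[OF N(1) meas N(3,4) assms(7) adm] eq by simp
  ultimately have "measure N ?A = ?I" by linarith
  then show "\<exists>(N :: 'a measure) X\<^sub>0. prob_space N \<and> X\<^sub>0 \<in> borel_measurable N \<and>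
      centered N X\<^sub>0 \<and> has_covariance N X\<^sub>0 \<Sigma> \<and>
      measure N {\<omega> \<in> space N. cone_ge C (X\<^sub>0 \<omega>) b} = ?I"
    using N meas by blast
qed

end
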